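(* For all primes $p\geq 10^{22}$, we have $g(p)<p^{5/8}$.
   Context: For an odd prime $p$, $g(p)$ denotes the least primitive root modulo $p$, i.e. the least positive integer that generates the multiplicative group $(\mathbb{Z}/p\mathbb{Z})^\times$. *)

theory Defs
  imports Complex_Main "HOL-Number_Theory.Number_Theory"
begin

(* residue_primroot p g: the residue class of g has order totient p = p - 1, i.e. generates the
   cyclic group (Z/pZ)^* (see residue_primroot_is_generator). Only meaningful if a primitive root
   exists, as is the case for prime moduli. *)
definition least_primroot :: "nat \<Rightarrow> nat" where
  "least_primroot p = (LEAST g. g > 0 \<and> residue_primroot p g)"

lemma least_primroot:
  assumes "prime p" "odd p"
  shows "least_primroot p > 0" "residue_primroot p (least_primroot p)"
    and "\<And>g. g > 0 \<Longrightarrow> residue_primroot p g \<Longrightarrow> least_primroot p \<le> g"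
proof -
  from assms obtain g where g: "residue_primroot p g"
    using prime_primitive_root_exists[of p] prime_gt_1_nat[of p] by blast
  have "g > 0"
    using g assms(1) by (cases "g = 0") auto
  with g have ex: "\<exists>g. g > 0 \<and> residue_primroot p g"
    by blast
  from LeastI_ex[OF ex] show "least_primroot p > 0" "residue_primroot p (least_primroot p)"
    by (simp_all add: least_primroot_def)
  show "least_primroot p \<le> g" if "g > 0" "residue_primroot p g" for g
    unfolding least_primroot_def using that by (intro Least_le) auto
qed

end

(*
  Let P be the set of prime divisors of p - 1. We look for a primitive root of the form a + b with
  1 <= a, b <= N, which gives g(p) <= 2 N.

  For a nontrivial character chi modulo p, completing one of the two sums and using the symmetry
  under negation gives |sum over a, b <= N of chi(a + b)| <= N * sqrt(p / 2), without any
  logarithm. A sieve then needs only N >= sqrt(p / 2) * 2^k * ((s - 1) / delta + 2): the indicator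
  of primitive roots is expanded in characters over a core of k primes of P, the other s primes are
  sieved out by a union bound, and delta = 1 - sum of 1/q over those s primes. It remains to choose
  a core for which this is less than about p^(5/8) / 2: for at most 39 primes, 2, 3, 5 and enough
  others to make three; for more primes, the smaller half.
*)
theory Submission
  imports Defs "HOL-Library.FuncSet"
begin

section \<open>Character sums over sums of two intervals\<close>

lemma sum_residues_shift:
  fixes f :: "int \<Rightarrow> 'a :: comm_monoid_add" and p c :: int
  assumes "p > 0" and per: "\<And>x. f (x mod p) = f x"
  shows "(\<Sum>x\<in>{0..<p}. f (x + c)) = (\<Sum>x\<in>{0..<p}. f x)"
proof -
  have "(\<Sum>x\<in>{0..<p}. f ((x + c) mod p)) = (\<Sum>x\<in>{0..<p}. f x)"
    using \<open>p > 0\<close>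
    by (intro sum.reindex_bij_witness[of _ "\<lambda>x. (x - c) mod p" "\<lambda>x. (x + c) mod p"])
       (auto simp: mod_diff_left_eq mod_add_left_eq)
  thus ?thesis by (simp add: per)
qed

lemma sum_residues_scale:
  fixes f :: "int \<Rightarrow> 'a :: comm_monoid_add" and p c :: int
  assumes "p > 0" "coprime c p" and per: "\<And>x. f (x mod p) = f x"
  shows "(\<Sum>x\<in>{0..<p}. f (c * x)) = (\<Sum>x\<in>{0..<p}. f x)"
proof -
  obtain d where d: "[c * d = 1] (mod p)"
    using cong_solve_coprime_int[OF \<open>coprime c p\<close>] by blast
  have 1: "(d * (c * x mod p)) mod p = x" "(c * (d * x mod p)) mod p = x" if "x \<in> {0..<p}" for x
  proof -
    have "[c * d * x = 1 * x] (mod p)"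
      using d by (rule cong_mult) auto
    hence "(c * d * x) mod p = x"
      using that by (simp add: cong_def)
    thus "(d * (c * x mod p)) mod p = x" "(c * (d * x mod p)) mod p = x"
      by (simp_all add: mod_mult_right_eq mult_ac)
  qed
  have "(\<Sum>x\<in>{0..<p}. f ((c * x) mod p)) = (\<Sum>x\<in>{0..<p}. f x)"
    using \<open>p > 0\<close> 1
    by (intro sum.reindex_bij_witness[of _ "\<lambda>x. (d * x) mod p" "\<lambda>x. (c * x) mod p"]) auto
  thus ?thesis by (simp add: per)
qed

text \<open>Characters are axiomatised as periodic functions on the integers, so that the analytic
  estimates do not depend on their construction from discrete logarithms.\<close>

locale nontrivial_char =
  fixes p :: int and \<chi> :: "int \<Rightarrow> complex"
  assumes prime_p: "prime p"
  assumes periodic: "\<chi> (x mod p) = \<chi> x"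
  assumes mult: "\<chi> (x * y) = \<chi> x * \<chi> y"
  assumes zero: "p dvd x \<Longrightarrow> \<chi> x = 0"
  assumes norm_1: "\<not> p dvd x \<Longrightarrow> norm (\<chi> x) = 1"
  assumes nontrivial: "\<exists>x. \<not> p dvd x \<and> \<chi> x \<noteq> 1"
begin

lemma p_gt_1: "p > 1"
  using prime_p prime_gt_1_int by blast

lemma coprime_p: "\<not> p dvd x \<Longrightarrow> coprime x p"
  using prime_p by (metis coprime_commute prime_imp_coprime)

lemma char_cong: "[x = y] (mod p) \<Longrightarrow> \<chi> x = \<chi> y"
  using periodic[of x] periodic[of y] by (simp add: cong_def)

lemma char_cnj: "\<chi> x * cnj (\<chi> x) = (if p dvd x then 0 else 1)"
  using zero[of x] norm_1[of x] by (auto simp: complex_norm_square [symmetric])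

lemma char_1: "\<chi> 1 = 1"
  using mult[of 1 1] norm_1[of 1] p_gt_1 by auto

lemma sum_char: "(\<Sum>x\<in>{0..<p}. \<chi> x) = 0"
proof -
  obtain c where c: "\<not> p dvd c" "\<chi> c \<noteq> 1"
    using nontrivial by blast
  have "(\<Sum>x\<in>{0..<p}. \<chi> (c * x)) = (\<Sum>x\<in>{0..<p}. \<chi> x)"
    using p_gt_1 c coprime_p by (intro sum_residues_scale) (auto simp: periodic)
  hence "\<chi> c * (\<Sum>x\<in>{0..<p}. \<chi> x) = (\<Sum>x\<in>{0..<p}. \<chi> x)"
    by (simp add: mult sum_distrib_left)
  thus ?thesis using c by auto
qed

text \<open>For \<open>x\<close> prime to \<open>p\<close> the conjugate of \<open>\<chi> x\<close>
  is the value at the inverse of \<open>x\<close>, so the term equals \<chi>(1 + 1/x). Inversion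
  permutes the nonzero residues; what remains is a complete sum, which vanishes, without the term
  \<open>\<chi> 1\<close>.\<close>

lemma correlation_1: "(\<Sum>x\<in>{0..<p}. \<chi> (x + 1) * cnj (\<chi> x)) = - 1"
proof -
  \<comment> \<open>Inverses are normalised to lie in \<open>{1..<p}\<close>, which makes inversion
    an involution of the index set itself.\<close>
  define iv where "iv x = (SOME y. y \<in> {1..<p} \<and> [x * y = 1] (mod p))" for x
  have iv: "iv x \<in> {1..<p}" "[x * iv x = 1] (mod p)" if "x \<in> {1..<p}" for x
  proof -
    have "coprime x p"
      using that by (intro coprime_p) (auto dest: zdvd_imp_le)
    then obtain y where y: "[x * y = 1] (mod p)"
      using cong_solve_coprime_int by blast
    have "y mod p \<noteq> 0"
    proof
      assume "y mod p = 0"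
      hence "[x * y = x * 0] (mod p)"
        by (intro cong_mult) (auto simp: cong_def)
      with y have "[1 = 0] (mod p)"
        by (simp add: cong_def)
      thus False using p_gt_1 by (simp add: cong_def)
    qed
    moreover have "[x * (y mod p) = 1] (mod p)"
      using y by (simp add: cong_def mod_mult_right_eq)
    moreover have "y mod p \<ge> 0" "y mod p < p"
      using p_gt_1 by auto
    ultimately have "y mod p \<in> {1..<p} \<and> [x * (y mod p) = 1] (mod p)"
      by auto
    hence "iv x \<in> {1..<p} \<and> [x * iv x = 1] (mod p)"
      unfolding iv_def by (rule someI[where P = "\<lambda>y. y \<in> {1..<p} \<and> [x * y = 1] (mod p)"])
    thus "iv x \<in> {1..<p}" "[x * iv x = 1] (mod p)" by auto
  qed
  have iv_iv: "iv (iv x) = x" if "x \<in> {1..<p}" for x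
  proof -
    have "[x * iv x * iv (iv x) = 1 * iv (iv x)] (mod p)"
      by (intro cong_mult iv that cong_refl)
    moreover have "[x * (iv x * iv (iv x)) = x * 1] (mod p)"
      by (intro cong_mult iv that cong_refl)
    ultimately have "[iv (iv x) = x] (mod p)"
      by (simp add: mult.assoc cong_def)
    thus ?thesis using iv[OF that] iv[OF iv(1)[OF that]] that
      by (auto simp: cong_def)
  qed
  have *: "\<chi> (x + 1) * cnj (\<chi> x) = \<chi> (1 + iv x)" if "x \<in> {1..<p}" for x
  proof -
    have x: "\<not> p dvd x" using that by (auto dest: zdvd_imp_le)
    have "\<chi> x * \<chi> (iv x) = 1"
      using char_cong[OF iv(2)[OF that]] by (simp add: mult char_1)
    hence "cnj (\<chi> x) = \<chi> (iv x)"
      using char_cnj[of x] x by (metis mult_cancel_left mult_zero_left zero_neq_one)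
    hence "\<chi> (x + 1) * cnj (\<chi> x) = \<chi> ((x + 1) * iv x)"
      by (simp add: mult)
    also have "\<dots> = \<chi> (1 + iv x)"
    proof (rule char_cong)
      have "[x * iv x + iv x = 1 + iv x] (mod p)"
        by (intro cong_add iv that cong_refl)
      thus "[(x + 1) * iv x = 1 + iv x] (mod p)"
        by (simp add: algebra_simps)
    qed
    finally show ?thesis .
  qed
  have split: "{0..<p} = insert 0 {1..<p}" using p_gt_1 by auto
  have "(\<Sum>x\<in>{0..<p}. \<chi> (x + 1) * cnj (\<chi> x)) = (\<Sum>x\<in>{1..<p}. \<chi> (x + 1) * cnj (\<chi> x))"
    by (simp add: split zero)
  also have "\<dots> = (\<Sum>x\<in>{1..<p}. \<chi> (1 + iv x))"
    by (intro sum.cong refl *)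
  also have "\<dots> = (\<Sum>x\<in>{1..<p}. \<chi> (1 + x))"
    by (intro sum.reindex_bij_witness[of _ iv iv]) (use iv iv_iv in auto)
  also have "\<dots> = (\<Sum>x\<in>{0..<p}. \<chi> (x + 1)) - 1"
    by (simp add: split char_1 add.commute)
  also have "(\<Sum>x\<in>{0..<p}. \<chi> (x + 1)) = 0"
    using sum_residues_shift[of p \<chi> 1] p_gt_1 sum_char by (simp add: periodic)
  finally show ?thesis by simp
qed

text \<open>Translation by \<open>b\<close> leaves only the difference \<open>h = a - b\<close>. If
  \<open>p\<close> divides \<open>h\<close>, the terms are squared moduli; otherwise the
  substitution of \<open>h * x\<close> for \<open>x\<close> pulls out a factor of modulus 1 and
  reduces to the shift 1.\<close>

lemma correlation:
  "(\<Sum>x\<in>{0..<p}. \<chi> (x + a) * cnj (\<chi> (x + b))) = (if [a = b] (mod p) then p else 0) - 1"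
proof -
  define h where "h = a - b"
  define f where "f x = \<chi> (x + h) * cnj (\<chi> x)" for x
  have per: "f (x mod p) = f x" for x
    unfolding f_def using char_cong[of "x mod p + h" "x + h"]
    by (simp add: periodic cong_def mod_add_left_eq)
  have shift: "(\<Sum>x\<in>{0..<p}. \<chi> (x + a) * cnj (\<chi> (x + b))) = (\<Sum>x\<in>{0..<p}. f x)"
    using sum_residues_shift[of p f b] p_gt_1 per by (simp add: f_def h_def algebra_simps)
  show ?thesis
  proof (cases "p dvd h")
    case True
    have "f x = (if p dvd x then 0 else 1)" for x
      using True char_cong[of "x + h" x] by (simp add: f_def char_cnj cong_iff_dvd_diff)
    moreover have "{0..<p} = insert 0 {1..<p}" using p_gt_1 by auto
    moreover have "\<not> p dvd x" if "x \<in> {1..<p}" for x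
      using that by (auto dest: zdvd_imp_le)
    ultimately have "(\<Sum>x\<in>{0..<p}. f x) = p - 1"
      using p_gt_1 by (simp add: of_nat_diff)
    thus ?thesis using shift True by (simp add: h_def cong_iff_dvd_diff)
  next
    case False
    have "(\<Sum>x\<in>{0..<p}. f x) = (\<Sum>x\<in>{0..<p}. f (h * x))"
      using sum_residues_scale[of p h f] p_gt_1 per coprime_p[OF False] by simp
    also have "\<dots> = (\<Sum>x\<in>{0..<p}. \<chi> (x + 1) * cnj (\<chi> x))"
    proof (intro sum.cong refl)
      fix x
      have "f (h * x) = \<chi> (h * (x + 1)) * cnj (\<chi> (h * x))"
        by (simp add: f_def algebra_simps)
      also have "\<dots> = (\<chi> h * cnj (\<chi> h)) * (\<chi> (x + 1) * cnj (\<chi> x))"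
        by (simp add: mult)
      finally show "f (h * x) = \<chi> (x + 1) * cnj (\<chi> x)"
        using False by (simp add: char_cnj)
    qed
    also have "\<dots> = -1" by (rule correlation_1)
    finally show ?thesis using shift False by (simp add: h_def cong_iff_dvd_diff)
  qed
qed

text \<open>Squaring out gives N^2 correlations. As \<open>N < p\<close>, distinct shifts are
  incongruent, so only the N diagonal pairs contribute \<open>p\<close>, and every pair contributes
  -1.\<close>

lemma second_moment:
  fixes N :: nat
  assumes "int N < p"
  shows "(\<Sum>b\<in>{0..<p}. (norm (\<Sum>a\<in>{1..int N}. \<chi> (b + a)))\<^sup>2) = N * (p - N)"
proof -
  let ?A = "{1..int N}"
  have "complex_of_real (\<Sum>b\<in>{0..<p}. (norm (\<Sum>a\<in>?A. \<chi> (b + a)))\<^sup>2) =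
        (\<Sum>b\<in>{0..<p}. \<Sum>a\<in>?A. \<Sum>a'\<in>?A. \<chi> (b + a) * cnj (\<chi> (b + a')))"
    by (simp only: of_real_sum complex_norm_square cnj_sum sum_product)
  also have "\<dots> = (\<Sum>a\<in>?A. \<Sum>b\<in>{0..<p}. \<Sum>a'\<in>?A. \<chi> (b + a) * cnj (\<chi> (b + a')))"
    by (rule sum.swap)
  also have "\<dots> = (\<Sum>a\<in>?A. \<Sum>a'\<in>?A. \<Sum>b\<in>{0..<p}. \<chi> (b + a) * cnj (\<chi> (b + a')))"
    by (intro sum.cong refl sum.swap)
  also have "\<dots> = (\<Sum>a\<in>?A. \<Sum>a'\<in>?A. (if a' = a then p else 0) - 1)"
  proof -
    have "[a = a'] (mod p) \<longleftrightarrow> a' = a" if "a \<in> ?A" "a' \<in> ?A" for a a'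
      using that assms by (auto simp: cong_def)
    thus ?thesis unfolding correlation of_int_sum by (intro sum.cong refl) auto
  qed
  also have "\<dots> = complex_of_real (real N * (p - N))"
    by (simp add: sum_subtractf sum.delta)
  finally show ?thesis by (subst (asm) of_real_eq_iff) simp
qed

text \<open>
  Reflecting \<open>a\<close> to \<open>N + 1 - a\<close> shows that the inner sum has the same modulus at \<open>b\<close> and at
  \<open>- b - N - 1\<close>, so the \<open>b\<close> in question carry at most half of the second moment. This is what
  saves a factor of \<open>sqrt 2\<close>.
\<close>
lemma norm_double_sum_le:
  fixes N :: nat
  assumes "3 * int N + 1 < p"
  shows "norm (\<Sum>(a, b)\<in>{1..int N}\<times>{1..int N}. \<chi> (a + b)) \<le> N * sqrt (p / 2)"
proof -
  let ?A = "{1..int N}"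
  define G where "G b = norm (\<Sum>a\<in>?A. \<chi> (b + a))" for b
  define \<tau> where "\<tau> b = p - b - int N - 1" for b
  have norm_minus: "norm (\<chi> (-1)) = 1"
    using p_gt_1 by (intro norm_1) (auto dest: zdvd_imp_le)
  have G_\<tau>: "G (\<tau> b) = G b" for b
  proof -
    have "(\<Sum>a\<in>?A. \<chi> (\<tau> b + a)) = (\<Sum>a\<in>?A. \<chi> (\<tau> b + (int N + 1 - a)))"
      by (intro sum.reindex_bij_witness[of _ "\<lambda>a. int N + 1 - a" "\<lambda>a. int N + 1 - a"]) auto
    also have "\<dots> = (\<Sum>a\<in>?A. \<chi> (-1) * \<chi> (b + a))"
    proof (intro sum.cong refl)
      fix a
      have "\<chi> (\<tau> b + (int N + 1 - a)) = \<chi> ((-1) * (b + a))"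
        by (intro char_cong) (simp add: \<tau>_def cong_iff_dvd_diff)
      thus "\<chi> (\<tau> b + (int N + 1 - a)) = \<chi> (-1) * \<chi> (b + a)"
        by (simp only: mult)
    qed
    finally show ?thesis
      by (simp add: G_def sum_distrib_left [symmetric] norm_mult norm_minus)
  qed
  have inj: "inj_on \<tau> ?A" by (auto simp: inj_on_def \<tau>_def)
  have "2 * (\<Sum>b\<in>?A. (G b)\<^sup>2) = (\<Sum>b\<in>?A. (G b)\<^sup>2) + (\<Sum>b\<in>\<tau> ` ?A. (G b)\<^sup>2)"
    by (simp add: sum.reindex[OF inj] G_\<tau>)
  \<comment> \<open>The term \<open>p\<close> in \<open>\<tau>\<close> moves the reflected points
    into \<open>{0..<p}\<close>. The smallest of them is p - 2N - 1, which exceeds N by the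
    hypothesis on \<open>p\<close>.\<close>
  also have "\<dots> = (\<Sum>b\<in>?A \<union> \<tau> ` ?A. (G b)\<^sup>2)"
    using assms by (intro sum.union_disjoint [symmetric]) (auto simp: \<tau>_def)
  also have "\<dots> \<le> (\<Sum>b\<in>{0..<p}. (G b)\<^sup>2)"
    using assms by (intro sum_mono2) (auto simp: \<tau>_def)
  also have "\<dots> = N * (p - N)"
    unfolding G_def using assms by (intro second_moment) auto
  also have "\<dots> \<le> N * real_of_int p"
    by (simp add: mult_left_mono)
  finally have moment: "(\<Sum>b\<in>?A. (G b)\<^sup>2) \<le> N * (p / 2)" by simp

  define c where "c = sqrt (p / 2)"
  have c: "c > 0" "c\<^sup>2 = p / 2" using p_gt_1 by (auto simp: c_def)
  \<comment> \<open>This replaces Cauchy-Schwarz; with this \<open>c\<close> both halves of the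
    bound sum to at most \<open>N * c / 2\<close>.\<close>
  have am_gm: "G b \<le> ((G b)\<^sup>2 / c + c) / 2" for b
    using c(1) sum_squares_bound[of "G b" c]
    by (simp add: field_simps power2_eq_square)
  have "(\<Sum>(a, b)\<in>?A\<times>?A. \<chi> (a + b)) = (\<Sum>a\<in>?A. \<Sum>b\<in>?A. \<chi> (a + b))"
    by (rule sum.cartesian_product [symmetric])
  hence "norm (\<Sum>(a, b)\<in>?A\<times>?A. \<chi> (a + b)) \<le> (\<Sum>b\<in>?A. G b)"
    unfolding G_def by (simp add: norm_sum)
  also have "\<dots> \<le> (\<Sum>b\<in>?A. ((G b)\<^sup>2 / c + c) / 2)"
    by (intro sum_mono am_gm)
  also have "\<dots> = ((\<Sum>b\<in>?A. (G b)\<^sup>2) / c + N * c) / 2"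
    by (simp add: sum.distrib sum_divide_distrib [symmetric])
  also have "\<dots> \<le> (N * c\<^sup>2 / c + N * c) / 2"
    using moment[folded c(2)] c(1) by (intro divide_right_mono add_right_mono) auto
  also have "\<dots> = N * c"
    using c by (simp add: power2_eq_square)
  finally show ?thesis by (simp add: c_def)
qed

end

section \<open>Discrete logarithms and characters\<close>

lemma cis_2pi_eq_1_imp_int:
  assumes "cis (2 * pi * t) = 1"
  shows "t \<in> \<int>"
proof -
  have "cos (2 * pi * t) = 1" using arg_cong[OF assms, of Re] by simp
  then obtain n :: int where "2 * pi * t = of_int n * 2 * pi"
    using cos_one_2pi_int by auto
  hence "t = n" by simp
  thus ?thesis by simp
qed

text \<open>A geometric sum without its term at 0: the remaining \<open>j\<close> will index, for
  prime \<open>q\<close>, the characters of exact order \<open>q\<close>.\<close>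

lemma sum_cis_multiples:
  fixes q m :: nat
  assumes "q > 0"
  shows "(\<Sum>j\<in>{1..<q}. cis (2 * pi * (j / q) * m)) = (if q dvd m then of_nat q - 1 else - 1)"
proof -
  define z where "z = cis (2 * pi * (m / q))"
  have pow: "cis (2 * pi * (j / q) * m) = z ^ j" for j
    unfolding z_def DeMoivre by (simp add: field_simps)
  have split: "{..<q} = insert 0 {1..<q}" using assms by auto
  have *: "(\<Sum>j\<in>{1..<q}. cis (2 * pi * (j / q) * m)) = (\<Sum>j<q. z ^ j) - 1"
    by (simp only: pow) (simp add: split)
  show ?thesis
  proof (cases "q dvd m")
    case True
    then obtain k where "m = q * k" by blast
    hence "z = 1" using assms by (simp add: z_def)
    thus ?thesis using * True by simp
  next
    case False
    have "z \<noteq> 1"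
    proof
      assume "z = 1"
      hence "real m / q \<in> \<int>" unfolding z_def by (rule cis_2pi_eq_1_imp_int)
      then obtain k where "real m / q = of_int k" by (auto elim: Ints_cases)
      hence "real_of_int (int m) = of_int (k * int q)" using assms by (simp add: field_simps)
      hence "int m = k * int q" by (subst (asm) of_int_eq_iff)
      hence "int q dvd int m" by simp
      thus False using False by simp
    qed
    moreover have "z ^ q = 1"
      unfolding z_def DeMoivre using assms by simp
    ultimately have "(\<Sum>j<q. z ^ j) = 0"
      by (simp add: geometric_sum)
    thus ?thesis using * False by simp
  qed
qed

text \<open>This keeps products of characters of distinct prime orders nontrivial. After clearing
  denominators, a fixed \<open>q\<close> in \<open>D\<close> divides every term except possibly its
  own, hence that one too; but \<open>q\<close> divides neither \<open>f q\<close> nor any other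
  prime in \<open>D\<close>.\<close>

lemma sum_fractions_not_int:
  fixes D :: "nat set" and f :: "nat \<Rightarrow> nat"
  assumes "finite D" "D \<noteq> {}" and prime: "\<And>q. q \<in> D \<Longrightarrow> prime q"
    and f: "\<And>q. q \<in> D \<Longrightarrow> 0 < f q \<and> f q < q"
  shows "(\<Sum>q\<in>D. real (f q) / real q) \<notin> \<int>"
proof
  assume "(\<Sum>q\<in>D. real (f q) / real q) \<in> \<int>"
  then obtain m where m: "(\<Sum>q\<in>D. real (f q) / real q) = of_int m"
    by (auto elim: Ints_cases)
  from \<open>D \<noteq> {}\<close> obtain q where q: "q \<in> D" by blast
  have nz: "real r \<noteq> 0" if "r \<in> D" for r using prime[OF that] by (auto dest: prime_gt_0_nat)
  have "real_of_int (\<Sum>r\<in>D. int (f r * \<Prod>(D - {r}))) = (\<Sum>r\<in>D. real (f r) / r * real (\<Prod>D))"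
    unfolding of_int_sum
  proof (intro sum.cong refl)
    fix r assume r: "r \<in> D"
    have "\<Prod>D = r * \<Prod>(D - {r})" using prod.remove[OF \<open>finite D\<close> r, of id] by simp
    thus "of_int (int (f r * \<Prod>(D - {r}))) = real (f r) / r * real (\<Prod>D)"
      using nz[OF r] by simp
  qed
  also have "\<dots> = of_int (m * int (\<Prod>D))"
    unfolding sum_distrib_right [symmetric] m by simp
  finally have "(\<Sum>r\<in>D. int (f r * \<Prod>(D - {r}))) = m * int (\<Prod>D)"
    by (simp only: of_int_eq_iff)
  also have "(\<Sum>r\<in>D. int (f r * \<Prod>(D - {r}))) =
      int (f q * \<Prod>(D - {q})) + (\<Sum>r\<in>D-{q}. int (f r * \<Prod>(D - {r})))"
    using \<open>finite D\<close> q by (rule sum.remove)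
  finally have eq: "int (f q * \<Prod>(D - {q})) =
      m * int (\<Prod>D) - (\<Sum>r\<in>D-{q}. int (f r * \<Prod>(D - {r})))"
    by linarith
  have "int q dvd int (f q * \<Prod>(D - {q}))"
    unfolding eq
  proof (intro dvd_diff dvd_sum)
    have "q dvd \<Prod>D"
      using dvd_prodI[OF \<open>finite D\<close> q, of "\<lambda>x. x"] .
    thus "int q dvd m * int (\<Prod>D)"
      by (intro dvd_mult) (simp only: int_dvd_int_iff)
  next
    fix r assume "r \<in> D - {q}"
    hence "q \<in> D - {r}" using q by blast
    hence "q dvd \<Prod>(D - {r})"
      using dvd_prodI[of "D - {r}" q "\<lambda>x. x"] \<open>finite D\<close> by blast
    thus "int q dvd int (f r * \<Prod>(D - {r}))"
      unfolding int_dvd_int_iff by (rule dvd_mult)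
  qed
  hence "q dvd f q * \<Prod>(D - {q})"
    by (simp only: int_dvd_int_iff)
  moreover have "\<not> q dvd f q"
    using f[OF q] by (auto dest: dvd_imp_le)
  ultimately have "q dvd \<Prod>(D - {q})"
    using prime[OF q] by (simp add: prime_dvd_mult_iff)
  then obtain r where r: "r \<in> D - {q}" "q dvd r"
    using prime_dvd_prod_iff[of "D - {q}" q "\<lambda>x. x"] prime[OF q] \<open>finite D\<close> by blast
  hence "q = r"
    using prime[OF q] prime[of r] primes_dvd_imp_eq by blast
  with r show False by blast
qed

section \<open>Indices to the base of a primitive root, and the characters they define\<close>

locale primroot =
  fixes p g :: nat
  assumes prime: "prime p" and primroot: "residue_primroot p g"
begin

text \<open>The index is an arbitrary exponent, determined only modulo \<open>p - 1\<close>, and has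
  no meaning at multiples of \<open>p\<close>. Facts about it are therefore congruences or need
  \<open>x\<close> prime to \<open>p\<close>.\<close>

definition ind :: "int \<Rightarrow> nat" where
  "ind x = (SOME i. [int g ^ i = x] (mod int p))"

lemma p_gt_1: "p > 1"
  using prime prime_gt_1_nat by blast

lemma coprime_g: "coprime p g" and ord_g: "ord p g = p - 1"
  using primroot prime by (auto simp: residue_primroot_def totient_prime)

lemma not_dvd_g: "\<not> int p dvd int g"
proof
  assume "int p dvd int g"
  hence "is_unit p" using coprime_g coprime_absorb_left[of p g] by simp
  thus False using p_gt_1 by simp
qed

lemma power_ind:
  assumes "\<not> int p dvd x"
  shows "[int g ^ ind x = x] (mod int p)"
proof -
  define n where "n = nat (x mod int p)"
  have n: "int n = x mod int p" using p_gt_1 by (simp add: n_def)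
  have "n \<noteq> 0" using assms n by (auto simp: dvd_eq_mod_eq_0)
  moreover have "n < p" using n p_gt_1 by (metis of_nat_0_less_iff of_nat_less_iff pos_mod_bound prime prime_gt_0_nat)
  ultimately have "n \<in> totatives p"
    using prime by (simp add: totatives_prime)
  hence "n \<in> (\<lambda>i. g ^ i mod p) ` {..<totient p}"
    using residue_primroot_is_generator[OF p_gt_1 primroot] by (simp add: bij_betw_def)
  then obtain i where i: "g ^ i mod p = n" by blast
  have "int g ^ i mod int p = x mod int p"
    using i n by (metis of_nat_mod of_nat_power)
  hence "[int g ^ i = x] (mod int p)"
    by (simp add: cong_def)
  thus ?thesis unfolding ind_def by (rule someI[where P = "\<lambda>i. [int g ^ i = x] (mod int p)"])
qed

lemma ind_mod: "ind (x mod int p) = ind x"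
  by (simp add: ind_def cong_def)

lemma power_cong_iff: "[int g ^ i = int g ^ j] (mod int p) \<longleftrightarrow> [i = j] (mod (p - 1))"
  using order_divides_expdiff[OF coprime_g, of i j]
  by (simp add: ord_g cong_int_iff flip: of_nat_power)

lemma ind_mult:
  assumes "\<not> int p dvd x" "\<not> int p dvd y"
  shows "[ind (x * y) = ind x + ind y] (mod (p - 1))"
proof -
  have "\<not> int p dvd x * y"
    using assms prime by (simp add: prime_dvd_mult_iff)
  hence "[int g ^ ind (x * y) = x * y] (mod int p)"
    by (rule power_ind)
  also have "[x * y = int g ^ ind x * int g ^ ind y] (mod int p)"
    by (intro cong_mult cong_sym[OF power_ind] assms)
  finally show ?thesis
    by (simp add: power_cong_iff flip: power_add)
qed

lemma ind_g: "[ind (int g) = 1] (mod (p - 1))"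
proof -
  from power_ind[OF not_dvd_g] show ?thesis
    using power_cong_iff[of "ind (int g)" 1] by simp
qed

text \<open>The power \<open>g ^ i\<close> has order (p - 1) / gcd(i, p - 1). The sieve will supply
  the coprimality one prime factor of \<open>p - 1\<close> at a time.\<close>

lemma residue_primroot_if_coprime_ind:
  assumes "\<not> int p dvd int n" "coprime (ind (int n)) (p - 1)"
  shows "residue_primroot p n"
proof -
  have "[int (g ^ ind (int n)) = int n] (mod int p)"
    using power_ind[OF assms(1)] by simp
  hence cong: "[g ^ ind (int n) = n] (mod p)"
    by (simp only: cong_int_iff)
  have "gcd (ind (int n)) (p - 1) = 1"
    using assms(2) by (simp only: coprime_iff_gcd_eq_1)
  hence "ord p (g ^ ind (int n)) = p - 1"
    by (simp only: ord_power[OF coprime_g] ord_g div_by_1)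
  hence "ord p n = p - 1"
    by (simp only: ord_cong[OF cong])
  moreover have "coprime p n"
    using assms(1) by (intro prime_imp_coprime prime) (simp only: int_dvd_int_iff simp_thms)
  ultimately show ?thesis
    using prime p_gt_1 by (simp add: residue_primroot_def totient_prime)
qed

text \<open>The real frequency \<open>t\<close> yields a character when \<open>t * (p - 1)\<close>
  is an integer, and adding frequencies multiplies characters. For a prime \<open>q\<close> dividing
  \<open>p - 1\<close> and 0 < j < q, the frequency j / q gives order \<open>q\<close>.\<close>

definition char :: "real \<Rightarrow> int \<Rightarrow> complex" where
  "char t x = (if int p dvd x then 0 else cis (2 * pi * t * ind x))"

lemma cis_cong:
  fixes t :: real
  assumes "t * real (p - 1) \<in> \<int>" "[i = j] (mod (p - 1))"
  shows "cis (2 * pi * t * real i) = cis (2 * pi * t * real j)"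
proof -
  have "[int i = int j] (mod int (p - 1))"
    using assms(2) by (simp only: cong_int_iff)
  then obtain k where "int j = int i + int (p - 1) * k"
    using cong_iff_lin by blast
  hence "real_of_int (int j) = real_of_int (int i + int (p - 1) * k)"
    by (rule arg_cong)
  hence "2 * pi * t * real j = 2 * pi * t * real i + 2 * pi * (t * real (p - 1) * of_int k)"
    by (simp add: algebra_simps)
  hence "cis (2 * pi * t * real j) = cis (2 * pi * t * real i) * cis (2 * pi * (t * real (p - 1) * of_int k))"
    by (simp add: cis_mult)
  also have "cis (2 * pi * (t * real (p - 1) * of_int k)) = 1"
    by (rule cis_multiple_2pi[OF Ints_mult[OF assms(1) Ints_of_int]])
  finally show ?thesis by simp
qed

lemma nontrivial_char:
  fixes t :: real
  assumes t: "t * real (p - 1) \<in> \<int>" "t \<notin> \<int>"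
  shows "nontrivial_char (int p) (char t)"
proof
  show "prime (int p)" using prime by simp
next
  fix x show "char t (x mod int p) = char t x"
    by (simp add: char_def ind_mod dvd_mod_iff)
next
  fix x y
  show "char t (x * y) = char t x * char t y"
  proof (cases "int p dvd x \<or> int p dvd y")
    case False
    hence "cis (2 * pi * t * ind (x * y)) = cis (2 * pi * t * real (ind x + ind y))"
      by (intro cis_cong t ind_mult) auto
    thus ?thesis using False prime
      by (simp add: char_def prime_dvd_mult_iff cis_mult ring_distribs)
  qed (auto simp: char_def)
next
  \<comment> \<open>The generator has index 1 modulo \<open>p - 1\<close>, so it detects whether
    \<open>t\<close> is an integer.\<close>
  have "char t (int g) = cis (2 * pi * t * real 1)"
    unfolding char_def using not_dvd_g cis_cong[OF t(1) ind_g] by simp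
  hence "char t (int g) \<noteq> 1"
    using cis_2pi_eq_1_imp_int[of t] t(2) by auto
  with not_dvd_g show "\<exists>x. \<not> int p dvd x \<and> char t x \<noteq> 1" by blast
qed (auto simp: char_def)

text \<open>
  The normalised Ramanujan sum: the average at \<open>x\<close> of the characters of exact order \<open>q\<close>, so that
  products over distinct primes are again averages of nontrivial characters.
\<close>
definition ramanujan :: "nat \<Rightarrow> int \<Rightarrow> real" where
  "ramanujan q x = (if q dvd ind x then 1 else - 1 / (real q - 1))"

text \<open>Multiplying out the averages picks one numerator per prime, hence one character for each
  choice function \<open>f\<close>; its frequency is the sum of the chosen fractions.\<close>

lemma prod_ramanujan_eq:
  assumes "finite D" and D: "\<And>q. q \<in> D \<Longrightarrow> prime q" and "\<not> int p dvd x"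
  shows "complex_of_real (\<Prod>q\<in>D. ramanujan q x) =
           (\<Sum>f\<in>PiE D (\<lambda>q. {1..<q}). char (\<Sum>q\<in>D. real (f q) / real q) x) / of_nat (\<Prod>q\<in>D. q - 1)"
proof -
  have cis_sum: "(\<Prod>q\<in>D. cis (h q)) = cis (\<Sum>q\<in>D. h q)" for h
    using \<open>finite D\<close> by induction (auto simp: cis_mult)
  have 1: "(\<Sum>j\<in>{1..<q}. cis (2 * pi * (real j / real q) * ind x)) =
             of_nat (q - 1) * complex_of_real (ramanujan q x)"
    and 2: "of_nat (q - 1) \<noteq> (0 :: complex)" if "q \<in> D" for q
  proof -
    have q: "q > 1" using D[OF that] by (rule prime_gt_1_nat)
    thus "of_nat (q - 1) \<noteq> (0 :: complex)" by (simp only: of_nat_eq_0_iff)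
    have "real (q - 1) * ramanujan q x = (if q dvd ind x then real q - 1 else - 1)"
      using q by (simp add: ramanujan_def of_nat_diff)
    from arg_cong[OF this, of complex_of_real]
    have "of_nat (q - 1) * complex_of_real (ramanujan q x) =
            complex_of_real (if q dvd ind x then real q - 1 else - 1)"
      by (simp only: of_real_mult of_real_of_nat_eq)
    thus "(\<Sum>j\<in>{1..<q}. cis (2 * pi * (real j / real q) * ind x)) =
             of_nat (q - 1) * complex_of_real (ramanujan q x)"
      using q by (subst sum_cis_multiples) auto
  qed
  have "(\<Sum>f\<in>PiE D (\<lambda>q. {1..<q}). char (\<Sum>q\<in>D. real (f q) / real q) x) =
        (\<Sum>f\<in>PiE D (\<lambda>q. {1..<q}). \<Prod>q\<in>D. cis (2 * pi * (real (f q) / real q) * ind x))"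
    unfolding char_def cis_sum sum_distrib_left sum_distrib_right using assms(3) by simp
  also have "\<dots> = (\<Prod>q\<in>D. \<Sum>j\<in>{1..<q}. cis (2 * pi * (real j / real q) * ind x))"
    by (intro prod_sum_PiE [symmetric] \<open>finite D\<close>) auto
  also have "\<dots> = (\<Prod>q\<in>D. of_nat (q - 1) * complex_of_real (ramanujan q x))"
    by (intro prod.cong refl 1)
  also have "\<dots> = of_nat (\<Prod>q\<in>D. q - 1) * complex_of_real (\<Prod>q\<in>D. ramanujan q x)"
    by (simp add: prod.distrib)
  finally show ?thesis
    using 2 \<open>finite D\<close> by simp
qed

text \<open>The product is an average of nontrivial characters, and each of them satisfies
  \<open>norm_double_sum_le\<close>. The number of characters cancels, so the bound is the same for
  every \<open>D\<close>.\<close>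

lemma sum_prod_ramanujan_le:
  fixes N :: nat
  assumes "D \<subseteq> prime_factors (p - 1)" "D \<noteq> {}" and N: "3 * N + 1 < p"
  shows "\<bar>\<Sum>(a, b)\<in>{1..int N}\<times>{1..int N}. \<Prod>q\<in>D. ramanujan q (a + b)\<bar> \<le> N * sqrt (p / 2)"
proof -
  let ?X = "{1..int N} \<times> {1..int N}"
  define F where "F = PiE D (\<lambda>q. {1..<q})"
  define c where "c = (\<Prod>q\<in>D. q - 1)"
  define t where "t f = (\<Sum>q\<in>D. real (f q) / q)" for f :: "nat \<Rightarrow> nat"
  have fin: "finite D" using assms(1) by (rule finite_subset) auto
  have D: "prime q" "q dvd p - 1" if "q \<in> D" for q
  proof -
    have "q \<in> prime_factors (p - 1)" using that assms(1) by blast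
    thus "prime q" "q dvd p - 1" by blast+
  qed
  have "q - 1 > 0" if "q \<in> D" for q
    using prime_gt_1_nat[OF D(1)[OF that]] by simp
  hence c: "c > 0" unfolding c_def by (rule prod_pos)
  have "card F = c"
    using fin by (simp add: F_def c_def card_PiE)
  have char: "nontrivial_char (int p) (char (t f))" if "f \<in> F" for f
  proof (rule nontrivial_char)
    have "0 < f q \<and> f q < q" if "q \<in> D" for q
      using PiE_mem[OF \<open>f \<in> F\<close>[unfolded F_def] that] by simp
    with fin assms(2) D(1) show "t f \<notin> \<int>"
      unfolding t_def by (rule sum_fractions_not_int)
    have "real (f q) / q * real (p - 1) \<in> \<int>" if q: "q \<in> D" for q
    proof -
      obtain k where k: "p - 1 = q * k" using D(2)[OF q] by blast
      have "real (f q) / q * real (p - 1) = real (f q * k)"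
        unfolding k using prime_gt_0_nat[OF D(1)[OF q]] by simp
      thus ?thesis by (metis Ints_of_nat)
    qed
    thus "t f * real (p - 1) \<in> \<int>"
      unfolding t_def sum_distrib_right by (intro Ints_sum)
  qed
  have "complex_of_real (\<Prod>q\<in>D. ramanujan q (a + b)) =
          (\<Sum>f\<in>F. char (t f) (a + b)) / of_nat c" if "(a, b) \<in> ?X" for a b
  proof -
    \<comment> \<open>Here 0 < a + b <= 2N < p.\<close>
    have "\<not> int p dvd a + b"
      using that N by (auto dest: zdvd_imp_le)
    thus ?thesis
      unfolding c_def t_def F_def using fin D(1) by (intro prod_ramanujan_eq)
  qed
  hence "complex_of_real (\<Sum>(a, b)\<in>?X. \<Prod>q\<in>D. ramanujan q (a + b)) =
        (\<Sum>(a, b)\<in>?X. (\<Sum>f\<in>F. char (t f) (a + b)) / of_nat c)"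
    unfolding of_real_sum by (intro sum.cong refl) (auto simp del: of_real_prod)
  also have "\<dots> = (\<Sum>f\<in>F. \<Sum>(a, b)\<in>?X. char (t f) (a + b)) / of_nat c"
    unfolding case_prod_beta sum_divide_distrib by (rule sum.swap)
  finally have eq: "complex_of_real (\<Sum>(a, b)\<in>?X. \<Prod>q\<in>D. ramanujan q (a + b)) =
      (\<Sum>f\<in>F. \<Sum>(a, b)\<in>?X. char (t f) (a + b)) / of_nat c" .
  have "\<bar>\<Sum>(a, b)\<in>?X. \<Prod>q\<in>D. ramanujan q (a + b)\<bar> =
      norm (\<Sum>f\<in>F. \<Sum>(a, b)\<in>?X. char (t f) (a + b)) / c"
    using arg_cong[OF eq, of norm] by (simp only: norm_divide norm_of_nat norm_of_real)
  also have "\<dots> \<le> (\<Sum>f\<in>F. N * sqrt (p / 2)) / c"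
  proof (intro divide_right_mono sum_norm_le)
    fix f assume "f \<in> F"
    then interpret nontrivial_char "int p" "char (t f)" by (rule char)
    show "norm (\<Sum>(a, b)\<in>?X. char (t f) (a + b)) \<le> N * sqrt (p / 2)"
      using norm_double_sum_le[of N] N by simp
  qed auto
  also have "\<dots> = N * sqrt (p / 2)"
    using c \<open>card F = c\<close> by simp
  finally show ?thesis .
qed

end

section \<open>A weighted sieve in abstract form, then its application to the sums a + b\<close>

section \<open>The sieve\<close>

text \<open>
  Each \<open>r q\<close> takes the value \<open>1\<close> on the \<open>q\<close>-th powers and has mean \<open>0\<close>. The core \<open>K\<close> is treated by
  inclusion-exclusion, while for the primes in \<open>S\<close> the crude lower bound \<open>1 - (\<Sum>q\<in>S. [r q x = 1])\<close>
  for the sieve weight costs only a factor linear in \<open>card S\<close>.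
\<close>
lemma sieve:
  fixes r :: "nat \<Rightarrow> 'a \<Rightarrow> real" and K S :: "nat set" and E \<delta> :: real
  assumes fin: "finite X" "finite K" "finite S" and disj: "K \<inter> S = {}"
    and ge_2: "\<And>q. q \<in> K \<union> S \<Longrightarrow> q \<ge> 2"
    and r: "\<And>q x. q \<in> K \<union> S \<Longrightarrow> r q x = 1 \<or> r q x = - 1 / (real q - 1)"
    and E: "\<And>D. D \<subseteq> K \<union> S \<Longrightarrow> D \<noteq> {} \<Longrightarrow> \<bar>\<Sum>x\<in>X. \<Prod>q\<in>D. r q x\<bar> \<le> E"
    and \<delta>_def: "\<delta> = 1 - (\<Sum>q\<in>S. 1 / q)" and "\<delta> > 0" and "E > 0"
    and large: "\<delta> * card X \<ge> E * 2 ^ card K * (real (card S) - 1 + 2 * \<delta>)"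
  shows "\<exists>x\<in>X. \<forall>q\<in>K \<union> S. r q x \<noteq> 1"
proof (rule ccontr)
  assume contra: "\<not> (\<exists>x\<in>X. \<forall>q\<in>K \<union> S. r q x \<noteq> 1)"
  define G where "G x = (\<Prod>q\<in>K. 1 - r q x)" for x
  define H where "H x = \<delta> - (\<Sum>q\<in>S. (1 - 1 / q) * r q x)" for x
  define T where "T D = (\<Sum>x\<in>X. \<Prod>q\<in>D. r q x)" for D
  have r_le_1: "r q x \<le> 1" if "q \<in> K \<union> S" for q x
  proof -
    have "- 1 / (real q - 1) \<le> 0" using ge_2[OF that] by simp
    with r[OF that, of x] show ?thesis by (elim disjE) linarith+
  qed
  \<comment> \<open>If every \<open>x\<close> fails at some prime, the weight is never positive: a
    failure in \<open>K\<close> makes \<open>G x\<close> vanish, and a failure in \<open>S\<close>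
    makes \<open>H x\<close> nonpositive while \<open>G x\<close> is nonnegative.\<close>
  have "G x * H x \<le> 0" if "x \<in> X" for x
  proof -
    from contra that obtain q where q: "q \<in> K \<union> S" "r q x = 1" by blast
    show ?thesis
    proof (cases "q \<in> K")
      case True
      hence "G x = 0" unfolding G_def using fin(2) q by (intro prod_zero) auto
      thus ?thesis by simp
    next
      case False
      \<comment> \<open>\<open>z q\<close> is the indicator of \<open>r q x = 1\<close>, so
        \<open>H x\<close> is 1 minus the number of failures in \<open>S\<close>.\<close>
      define z where "z q = 1 / q + (1 - 1 / q) * r q x" for q
      have "z q \<ge> 0" if "q \<in> S" for q
        using r[of q x] ge_2[of q] that by (auto simp: z_def field_simps)
      hence "z q \<le> (\<Sum>q\<in>S. z q)"
        using fin q False by (intro member_le_sum) auto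
      moreover have "z q = 1" using q by (simp add: z_def)
      moreover have "H x = 1 - (\<Sum>q\<in>S. z q)"
        by (simp add: H_def z_def \<delta>_def sum.distrib)
      ultimately have "H x \<le> 0" by simp
      moreover have "G x \<ge> 0"
        unfolding G_def using r_le_1 by (intro prod_nonneg) auto
      ultimately show ?thesis by (intro mult_nonneg_nonpos)
    qed
  qed
  hence "(\<Sum>x\<in>X. G x * H x) \<le> 0" by (rule sum_nonpos)

  have G_expand: "G x = (\<Sum>D\<in>Pow K. (-1) ^ card D * (\<Prod>q\<in>D. r q x))" for x
    unfolding G_def by (subst prod_diff_conv_sum[OF fin(2)]) simp
  have card_Pow: "card (Pow K) = 2 ^ card K"
    using fin(2) by (simp add: card_Pow)

  have "(\<Sum>x\<in>X. G x) = (\<Sum>D\<in>Pow K. (-1) ^ card D * T D)"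
    unfolding G_expand T_def sum_distrib_left by (rule sum.swap)
  \<comment> \<open>The empty set gives the main term; each of the other 2^|K| - 1 sets contributes
    at most \<open>E\<close>.\<close>
  also have "\<dots> = card X + (\<Sum>D\<in>Pow K - {{}}. (-1) ^ card D * T D)"
    using fin(2) by (subst sum.remove[of _ "{}"]) (auto simp: T_def)
  finally have "\<bar>(\<Sum>x\<in>X. G x) - card X\<bar> = \<bar>\<Sum>D\<in>Pow K - {{}}. (-1) ^ card D * T D\<bar>"
    by simp
  also have "\<dots> \<le> (\<Sum>D\<in>Pow K - {{}}. \<bar>(-1) ^ card D * T D\<bar>)"
    by (rule sum_abs)
  also have "\<dots> \<le> (\<Sum>D\<in>Pow K - {{}}. E)"
    by (intro sum_mono) (use E in \<open>auto simp: abs_mult T_def\<close>)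
  also have "\<dots> = (2 ^ card K - 1) * E"
    using fin(2) by (simp add: card_Diff_singleton card_Pow of_nat_diff)
  finally have sum_G: "(\<Sum>x\<in>X. G x) \<ge> card X - (2 ^ card K - 1) * E"
    by linarith

  \<comment> \<open>As \<open>q\<close> lies outside \<open>K\<close>, multiplying by
    \<open>r q x\<close> replaces each \<open>D\<close> by the nonempty set
    \<open>insert q D\<close>, so no main term appears.\<close>
  have sum_Gr: "(\<Sum>x\<in>X. G x * r q x) \<le> 2 ^ card K * E" if q: "q \<in> S" for q
  proof -
    have ins: "(\<Prod>q\<in>D. r q x) * r q x = (\<Prod>q\<in>insert q D. r q x)" if "D \<in> Pow K" for D x
    proof -
      have "finite D" "q \<notin> D" using that q disj fin(2) by (auto intro: finite_subset)
      thus ?thesis by simp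
    qed
    have "(\<Sum>x\<in>X. G x * r q x) = (\<Sum>x\<in>X. \<Sum>D\<in>Pow K. (-1) ^ card D * (\<Prod>q\<in>insert q D. r q x))"
      unfolding G_expand sum_distrib_right
      by (intro sum.cong refl) (simp only: ins [symmetric] mult.assoc)
    also have "\<dots> = (\<Sum>D\<in>Pow K. (-1) ^ card D * T (insert q D))"
      unfolding T_def sum_distrib_left by (rule sum.swap)
    also have "\<dots> \<le> (\<Sum>D\<in>Pow K. E)"
    proof (intro sum_mono)
      fix D assume "D \<in> Pow K"
      hence "\<bar>T (insert q D)\<bar> \<le> E" unfolding T_def using q by (intro E) auto
      hence "\<bar>(-1) ^ card D * T (insert q D)\<bar> \<le> E" by (simp add: abs_mult)
      thus "(-1) ^ card D * T (insert q D) \<le> E" by linarith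
    qed
    also have "\<dots> = 2 ^ card K * E"
      using fin(2) by (simp add: card_Pow)
    finally show ?thesis .
  qed

  have "(\<Sum>x\<in>X. G x * H x) = \<delta> * (\<Sum>x\<in>X. G x) - (\<Sum>x\<in>X. \<Sum>q\<in>S. (1 - 1 / q) * (G x * r q x))"
    by (simp add: H_def right_diff_distrib sum_subtractf sum_distrib_left mult_ac)
  also have "(\<Sum>x\<in>X. \<Sum>q\<in>S. (1 - 1 / q) * (G x * r q x)) =
             (\<Sum>q\<in>S. (1 - 1 / q) * (\<Sum>x\<in>X. G x * r q x))"
    unfolding sum_distrib_left by (rule sum.swap)
  finally have eq: "(\<Sum>x\<in>X. G x * H x) =
    \<delta> * (\<Sum>x\<in>X. G x) - (\<Sum>q\<in>S. (1 - 1 / q) * (\<Sum>x\<in>X. G x * r q x))" .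
  have "(\<Sum>q\<in>S. (1 - 1 / q) * (\<Sum>x\<in>X. G x * r q x)) \<le> (\<Sum>q\<in>S. (1 - 1 / q) * (2 ^ card K * E))"
  proof (intro sum_mono mult_left_mono sum_Gr)
    fix q assume "q \<in> S"
    thus "0 \<le> 1 - 1 / real q" using ge_2[of q] by simp
  qed
  also have "\<dots> = (real (card S) - 1 + \<delta>) * (2 ^ card K * E)"
    unfolding sum_distrib_right [symmetric] by (simp add: \<delta>_def sum_subtractf)
  finally have "(\<Sum>x\<in>X. G x * H x) \<ge>
      \<delta> * (card X - (2 ^ card K - 1) * E) - (real (card S) - 1 + \<delta>) * (2 ^ card K * E)"
    unfolding eq using mult_left_mono[OF sum_G, of \<delta>] \<open>\<delta> > 0\<close> by linarith
  \<comment> \<open>The surplus \<open>\<delta> * E\<close>, left over by 2^|K| - 1 in place of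
    2^|K|, makes the final inequality strict.\<close>
  also have "\<delta> * (card X - (2 ^ card K - 1) * E) - (real (card S) - 1 + \<delta>) * (2 ^ card K * E) =
      (\<delta> * card X - E * 2 ^ card K * (real (card S) - 1 + 2 * \<delta>)) + \<delta> * E"
    by (simp add: algebra_simps)
  finally have "(\<Sum>x\<in>X. G x * H x) > 0"
    using large mult_pos_pos[OF \<open>\<delta> > 0\<close> \<open>E > 0\<close>] by linarith
  thus False using \<open>(\<Sum>x\<in>X. G x * H x) \<le> 0\<close> by simp
qed

text \<open>The sieve runs over N^2 pairs with error \<open>N * sqrt (p / 2)\<close>; dividing its
  size condition by \<open>N * \<delta>\<close> gives \<open>large\<close>. For a surviving pair no
  prime factor of \<open>p - 1\<close> divides the index of a + b, which is thus a primitive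
  root.\<close>

lemma least_primroot_le:
  fixes p N :: nat and K :: "nat set" and \<delta> :: real
  defines "S \<equiv> prime_factors (p - 1) - K"
  assumes p: "prime p" "odd p" and N: "3 * N + 1 < p" "N > 0"
    and K: "K \<subseteq> prime_factors (p - 1)"
    and \<delta>_def: "\<delta> = 1 - (\<Sum>q\<in>S. 1 / q)" and \<delta>: "\<delta> > 0"
    and large: "N \<ge> sqrt (p / 2) * (2 ^ card K * ((real (card S) - 1) / \<delta> + 2))"
  shows "least_primroot p \<le> 2 * N"
proof -
  obtain g where "residue_primroot p g"
    using least_primroot(2)[OF p] by blast
  then interpret primroot p g using p by unfold_locales
  define X where "X = {1..int N} \<times> {1..int N}"
  define E where "E = N * sqrt (p / 2)"
  have KS: "K \<union> S = prime_factors (p - 1)" using K by (auto simp: S_def)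
  have "\<exists>x\<in>X. \<forall>q\<in>K \<union> S. ramanujan q (fst x + snd x) \<noteq> 1"
  proof (rule sieve[where \<delta> = \<delta> and E = E])
    show "finite X" "finite K" "finite S"
      using K by (auto simp: X_def S_def intro: finite_subset)
    show "K \<inter> S = {}" by (auto simp: S_def)
    show "\<delta> = 1 - (\<Sum>q\<in>S. 1 / q)" "\<delta> > 0" by fact+
    show "E > 0" using N p_gt_1 by (simp add: E_def)
    show "q \<ge> 2" if "q \<in> K \<union> S" for q
      using that unfolding KS by (intro prime_ge_2_nat) auto
    show "ramanujan q (fst x + snd x) = 1 \<or> ramanujan q (fst x + snd x) = - 1 / (real q - 1)" for q x
      by (simp add: ramanujan_def)
    show "\<bar>\<Sum>x\<in>X. \<Prod>q\<in>D. ramanujan q (fst x + snd x)\<bar> \<le> E" if "D \<subseteq> K \<union> S" "D \<noteq> {}" for D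
      using sum_prod_ramanujan_le[OF that(1)[unfolded KS] that(2) N(1)]
      by (simp add: X_def E_def case_prod_beta)
    have "E * 2 ^ card K * (real (card S) - 1 + 2 * \<delta>) =
          N * \<delta> * (sqrt (p / 2) * (2 ^ card K * ((real (card S) - 1) / \<delta> + 2)))"
      using \<delta> by (simp add: E_def field_simps)
    also have "\<dots> \<le> N * \<delta> * N"
      using large \<delta> by (intro mult_left_mono) auto
    also have "\<dots> = \<delta> * card X"
      by (simp add: X_def card_cartesian_product)
    finally show "E * 2 ^ card K * (real (card S) - 1 + 2 * \<delta>) \<le> \<delta> * card X" .
  qed
  then obtain a b where ab: "a \<in> {1..int N}" "b \<in> {1..int N}"
    and *: "\<And>q. q \<in> prime_factors (p - 1) \<Longrightarrow> \<not> q dvd ind (a + b)"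
    unfolding KS X_def by (fastforce simp: ramanujan_def)
  define n where "n = nat (a + b)"
  have n: "int n = a + b" "n > 0" "n \<le> 2 * N" using ab by (auto simp: n_def)
  have "residue_primroot p n"
  proof (rule residue_primroot_if_coprime_ind)
    show "\<not> int p dvd int n"
    proof
      assume "int p dvd int n"
      hence "p \<le> n" using n(2) by (intro dvd_imp_le) auto
      thus False using n(3) N by simp
    qed
    show "coprime (ind (int n)) (p - 1)"
    proof (rule ccontr)
      assume "\<not> coprime (ind (int n)) (p - 1)"
      hence "gcd (ind (int n)) (p - 1) \<noteq> 1"
        by (simp only: coprime_iff_gcd_eq_1 simp_thms)
      then obtain q where q: "prime q" "q dvd gcd (ind (int n)) (p - 1)"
        using prime_factor_nat by blast
      hence "q \<in> prime_factors (p - 1)"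
        using p_gt_1 by (intro prime_factorsI) auto
      with *[of q] q n show False by simp
    qed
  qed
  hence "least_primroot p \<le> n" using least_primroot(3)[OF p] n by blast
  thus ?thesis using n by simp
qed

text \<open>With y = p^(1/8) the hypothesis on \<open>B\<close> reads B <= 0.7 y, while sqrt(p/2) =
  y^4 / sqrt 2. As 0.7 is slightly less than 1 / sqrt 2, 2N stays below y^5 with room for rounding
  up.\<close>

lemma least_primroot_less:
  fixes p :: nat and K :: "nat set" and \<delta> B :: real
  defines "S \<equiv> prime_factors (p - 1) - K"
  defines "\<delta> \<equiv> 1 - (\<Sum>q\<in>S. 1 / q)"
  assumes p: "prime p" "p \<ge> 10 ^ 22"
    and K: "K \<subseteq> prime_factors (p - 1)" and \<delta>: "\<delta> > 0"
    and B: "2 ^ card K * ((real (card S) - 1) / \<delta> + 2) \<le> B" "(10 / 7 * B) ^ 8 \<le> p"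
  shows "real (least_primroot p) < real p powr (5 / 8)"
proof -
  define y where "y = real p powr (1 / 8)"
  have "p > 0" using p by (intro prime_gt_0_nat) auto
  hence y_pos: "y > 0" and p_eq: "real p = y ^ 8" and y5: "real p powr (5 / 8) = y ^ 5"
    by (simp_all add: y_def powr_powr flip: powr_realpow)
  have "real p \<ge> 10 ^ 22"
    using p(2) by (metis of_nat_le_iff of_nat_numeral of_nat_power)
  hence "(500::real) ^ 8 \<le> y ^ 8" unfolding p_eq by simp
  hence y: "y \<ge> 500" using y_pos by (simp only: power_mono_iff)
  have "(10 / 7 * B) ^ 8 \<le> y ^ 8" using B(2) by (simp only: p_eq)
  hence B_le: "B \<le> 7 / 10 * y"
    using y_pos power_le_imp_le_base[of "10 / 7 * B" 7 y] by simp
  have "odd p"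
    using p prime_odd_nat[of p] by simp

  define R where "R = sqrt (p / 2)"
  \<comment> \<open>The constant is a rational upper bound for 1 / sqrt 2.\<close>
  have "R \<le> 7072 / 10000 * y ^ 4"
    unfolding R_def p_eq using y_pos
    by (intro real_le_lsqrt) (simp_all add: power_mult_distrib power_divide flip: power_mult)
  have "R > 0" unfolding R_def using \<open>p > 0\<close> by simp
  define N where "N = nat \<lceil>7 / 10 * y * R\<rceil>"
  have pos: "7 / 10 * y * R > 0" using y_pos \<open>R > 0\<close> by simp
  have N_ge: "N \<ge> 7 / 10 * y * R" unfolding N_def by linarith
  have "N \<le> 7 / 10 * y * R + 1" unfolding N_def using pos by linarith
  also have "7 / 10 * y * R \<le> 7 / 10 * y * (7072 / 10000 * y ^ 4)"
    using y_pos \<open>R \<le> _\<close> by (intro mult_left_mono) auto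
  also have "\<dots> = 49504 / 100000 * y ^ 5"
    by (simp add: eval_nat_numeral)
  finally have N_le: "N \<le> 49504 / 100000 * y ^ 5 + 1" by simp
  have "y ^ 5 \<ge> 500 ^ 5" using y by (intro power_mono) auto
  hence y5_ge: "y ^ 5 \<ge> 1000000" by simp
  have "y ^ 8 = y ^ 3 * y ^ 5" by (simp flip: power_add)
  also have "y ^ 3 * y ^ 5 \<ge> 500 ^ 3 * y ^ 5" using y by (intro mult_right_mono power_mono) auto
  finally have "real p \<ge> 4 * y ^ 5" using y5_ge unfolding p_eq by simp

  have "least_primroot p \<le> 2 * N"
  proof (rule least_primroot_le[where K = K and \<delta> = \<delta>])
    have "real (3 * N + 1) < real p"
      using N_le y5_ge \<open>real p \<ge> 4 * y ^ 5\<close> by simp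
    thus "3 * N + 1 < p" by (simp only: of_nat_less_iff)
    show "N > 0" unfolding N_def using pos by simp
    have "R * (2 ^ card K * ((real (card S) - 1) / \<delta> + 2)) \<le> R * (7 / 10 * y)"
      using order.trans[OF B(1) B_le] \<open>R > 0\<close> by (intro mult_left_mono) auto
    also have "\<dots> \<le> N" using N_ge by (simp add: mult_ac)
    finally show "N \<ge> sqrt (p / 2) *
        (2 ^ card K * ((real (card (prime_factors (p - 1) - K)) - 1) / \<delta> + 2))"
      unfolding R_def S_def .
  qed (use p \<open>odd p\<close> K \<delta> in \<open>auto simp: \<delta>_def S_def\<close>)
  hence "real (least_primroot p) \<le> real (2 * N)" by (simp only: of_nat_le_iff)
  also have "real (2 * N) < y ^ 5" using N_le y5_ge by simp
  finally show ?thesis by (simp only: y5)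
qed

section \<open>Extremal bounds over finite sets of primes, then a core for each cardinality\<close>

section \<open>Choice of the core\<close>

text \<open>Subtracting 1/m from every term makes the terms nonnegative on \<open>U\<close> and
  nonpositive on the rest of \<open>S\<close>, so \<open>U\<close> maximises the shifted sum. This
  holds for any size of \<open>S\<close>, so one \<open>U\<close> serves a range of
  cardinalities.\<close>

lemma sum_reciprocals_le:
  fixes S U :: "nat set"
  assumes "finite S" "finite U" "m > 0"
    and "\<And>q. q \<in> U \<Longrightarrow> 0 < q \<and> q \<le> m" "\<And>q. q \<in> S - U \<Longrightarrow> m \<le> q"
  shows "(\<Sum>q\<in>S. 1 / real q) \<le> (real (card S) - real (card U)) / m + (\<Sum>q\<in>U. 1 / real q)"
proof -
  define h where "h q = 1 / real q - 1 / real m" for q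
  have neg: "h q \<le> 0" if "q \<in> S - U" for q
    using assms(5)[OF that] \<open>m > 0\<close> by (simp add: h_def frac_le)
  have pos: "h q \<ge> 0" if "q \<in> U" for q
    using assms(4)[OF that] by (simp add: h_def frac_le)
  have "(\<Sum>q\<in>S. h q) = (\<Sum>q\<in>S \<inter> U. h q) + (\<Sum>q\<in>S - U. h q)"
    using \<open>finite S\<close> by (rule sum.Int_Diff)
  also have "\<dots> \<le> (\<Sum>q\<in>U. h q) + 0"
    using neg pos \<open>finite U\<close> by (intro add_mono sum_mono2 sum_nonpos) auto
  finally show ?thesis
    by (simp add: h_def sum_subtractf diff_divide_distrib)
qed

text \<open>An exchange argument through \<open>m\<close>: elements of \<open>U\<close> missing from
  \<open>P\<close> are raised to \<open>m\<close>, and elements of \<open>P\<close> outside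
  \<open>U\<close> lowered to \<open>m\<close>. The powers of \<open>m\<close> balance the
  cardinalities without division.\<close>

lemma prod_ge:
  fixes P U :: "nat set"
  assumes "finite P" "finite U"
    and "\<And>q. q \<in> U \<Longrightarrow> q \<le> m" "\<And>q. q \<in> P - U \<Longrightarrow> m \<le> q"
  shows "m ^ card P * \<Prod>U \<le> m ^ card U * \<Prod>P"
proof -
  have card: "card P = card (P \<inter> U) + card (P - U)" "card U = card (P \<inter> U) + card (U - P)"
    using card_Int_Diff[OF assms(1), of U] card_Int_Diff[OF assms(2), of P]
    by (simp_all add: Int_commute)
  have "\<Prod>U = \<Prod>(U \<inter> P) * \<Prod>(U - P)"
    using prod.Int_Diff[OF assms(2), of "\<lambda>q. q" P] .
  also have "\<dots> \<le> \<Prod>(U \<inter> P) * (\<Prod>q\<in>U - P. m)"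
    using assms(3) by (intro mult_left_mono prod_mono) auto
  finally have "m ^ card P * \<Prod>U \<le> m ^ card P * (\<Prod>(P \<inter> U) * m ^ card (U - P))"
    by (intro mult_left_mono) (auto simp: Int_commute)
  also have "\<dots> = m ^ card U * (\<Prod>(P \<inter> U) * (\<Prod>q\<in>P - U. m))"
    by (simp add: card power_add)
  also have "\<dots> \<le> m ^ card U * (\<Prod>(P \<inter> U) * \<Prod>(P - U))"
    using assms(4) by (intro mult_left_mono prod_mono) auto
  also have "\<Prod>(P \<inter> U) * \<Prod>(P - U) = \<Prod>P"
    using prod.Int_Diff[OF assms(1), of "\<lambda>q. q" U] by simp
  finally show ?thesis .
qed

lemma primes_less_131:
  fixes q :: nat
  assumes "prime q" "q < 131"
  shows "q \<in> {2, 3, 5, 7, 11, 13, 17, 19, 23, 29, 31, 37, 41, 43, 47, 53, 59, 61, 67, 71, 73,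
              79, 83, 89, 97, 101, 103, 107, 109, 113, 127}"
proof -
  have "\<forall>q\<in>set [0..<131]. prime (q::nat) \<longrightarrow> q \<in> set [2, 3, 5, 7, 11, 13, 17, 19, 23, 29, 31, 37,
          41, 43, 47, 53, 59, 61, 67, 71, 73, 79, 83, 89, 97, 101, 103, 107, 109, 113, 127]"
    by code_simp
  thus ?thesis using assms by simp
qed

lemma exists_initial_segment:
  fixes P :: "'a :: linorder set"
  assumes "finite P" "k \<le> card P"
  obtains K where "K \<subseteq> P" "card K = k" "\<And>x y. x \<in> K \<Longrightarrow> y \<in> P - K \<Longrightarrow> x < y"
proof -
  have "\<exists>K\<subseteq>P. card K = k \<and> (\<forall>x\<in>K. \<forall>y\<in>P - K. x < y)"
    using assms(2)
  proof (induction k)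
    case (Suc k)
    then obtain K where K: "K \<subseteq> P" "card K = k" "\<And>x y. x \<in> K \<Longrightarrow> y \<in> P - K \<Longrightarrow> x < y"
      by (metis Suc_leD)
    have fin: "finite K" "finite (P - K)" using K(1) \<open>finite P\<close> by (auto intro: finite_subset)
    have "P - K \<noteq> {}"
      using Suc.prems K(1,2) by auto
    define m where "m = Min (P - K)"
    have m: "m \<in> P - K" "\<And>y. y \<in> P - K \<Longrightarrow> m \<le> y"
      using Min_in[of "P - K"] fin \<open>P - K \<noteq> {}\<close> by (auto simp: m_def)
    have "x < y" if "x \<in> insert m K" "y \<in> P - insert m K" for x y
      using that K(3)[of x y] m(2)[of y] by force
    thus ?case
      using K(1,2) m(1) fin by (intro exI[of _ "insert m K"]) auto
  qed auto
  thus ?thesis using that by blast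
qed

text \<open>Halving is injective on odd numbers, and 2 takes the slot 0 left free by 1, which is not
  prime.\<close>

lemma card_primes_below:
  fixes K :: "nat set"
  assumes "\<And>x. x \<in> K \<Longrightarrow> prime x \<and> x < y" "prime y"
  shows "2 * card K < y"
proof (cases "y = 2")
  case True
  have "K = {}"
  proof (rule ccontr)
    assume "K \<noteq> {}"
    then obtain x where "x \<in> K" by blast
    with assms(1) True prime_ge_2_nat[of x] show False by force
  qed
  thus ?thesis using True by simp
next
  case False
  hence "odd y" using \<open>prime y\<close> prime_ge_2_nat[of y] prime_odd_nat[of y] by force
  define h where "h x = (x - 1) div 2" for x :: nat
  have odd: "odd x \<or> x = 2" "x \<ge> 2" "x < y" if "x \<in> K" for x
    using assms(1)[OF that] prime_ge_2_nat[of x] prime_odd_nat[of x] by force+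
  have "inj_on h K"
  proof (rule inj_onI)
    fix u v assume "u \<in> K" "v \<in> K" "h u = h v"
    thus "u = v" using odd[of u] odd[of v] unfolding h_def by (auto elim!: oddE)
  qed
  moreover have "h ` K \<subseteq> {..<y div 2}"
  proof
    fix z assume "z \<in> h ` K"
    then obtain x where "x \<in> K" "z = h x" by blast
    thus "z \<in> {..<y div 2}" using odd[of x] \<open>odd y\<close> unfolding h_def by (auto elim!: oddE)
  qed
  ultimately have "card K \<le> y div 2"
    using card_inj_on_le[of h K "{..<y div 2}"] by simp
  thus ?thesis using \<open>odd y\<close> by (auto elim!: oddE)
qed

text \<open>The requirements of \<open>least_primroot_less\<close> on the core, with the prime
  factors of \<open>p - 1\<close> and \<open>p\<close> itself abstracted to \<open>P\<close> and
  \<open>Q\<close>.\<close>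

definition good_core :: "nat set \<Rightarrow> real \<Rightarrow> nat set \<Rightarrow> bool" where
  "good_core P Q K \<longleftrightarrow> K \<subseteq> P \<and> (\<Sum>q\<in>P - K. 1 / q) < 1 \<and>
     (\<exists>B. 2 ^ card K * ((real (card (P - K)) - 1) / (1 - (\<Sum>q\<in>P - K. 1 / q)) + 2) \<le> B \<and>
          (10 / 7 * B) ^ 8 \<le> Q)"

text \<open>The condition is monotone in the reciprocal sum and in the number of sieved primes, so
  upper bounds suffice. Monotonicity in \<open>\<sigma>\<close> needs \<open>1 \<le> t\<close>,
  since an empty \<open>P - K\<close> would give a negative numerator.\<close>

lemma good_coreI:
  fixes \<sigma> B Q t :: real
  assumes "K \<subseteq> P" "(\<Sum>q\<in>P - K. 1 / real q) \<le> \<sigma>" "\<sigma> < 1"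
    and "real (card (P - K)) \<le> t" "1 \<le> t"
    and "2 ^ card K * ((t - 1) / (1 - \<sigma>) + 2) \<le> B" "(10 / 7 * B) ^ 8 \<le> Q"
  shows "good_core P Q K"
proof -
  define \<delta> where "\<delta> = 1 - (\<Sum>q\<in>P - K. 1 / real q)"
  have \<delta>: "\<delta> \<ge> 1 - \<sigma>" "\<delta> > 0" using assms by (auto simp: \<delta>_def)
  have "(real (card (P - K)) - 1) / \<delta> \<le> (t - 1) / \<delta>"
    using \<delta> assms by (intro divide_right_mono) auto
  also have "\<dots> \<le> (t - 1) / (1 - \<sigma>)"
    using \<delta> assms by (intro divide_left_mono mult_pos_pos) auto
  finally have "2 ^ card K * ((real (card (P - K)) - 1) / \<delta> + 2) \<le> 2 ^ card K * ((t - 1) / (1 - \<sigma>) + 2)"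
    by (intro mult_left_mono) auto
  also have "\<dots> \<le> B" by fact
  finally show ?thesis
    using assms by (auto simp: good_core_def \<delta>_def)
qed

text \<open>A core of three primes containing those of 2, 3, 5 that lie in \<open>P\<close> leaves
  only primes from 7 on to be sieved. Their reciprocal sum is then compared with that of the primes
  from 7 to \<open>m\<close>.\<close>

lemma good_core_3:
  fixes P U :: "nat set" and \<sigma> B Q t :: real
  assumes P: "finite P" "\<And>q. q \<in> P \<Longrightarrow> prime q" "card P \<ge> 3" "real (card P) - 3 \<le> t" "1 \<le> t"
    and m: "m < 131"
    and U: "U = {7, 11, 13, 17, 19, 23, 29, 31, 37, 41, 43, 47, 53, 59, 61, 67, 71, 73,
              79, 83, 89, 97, 101, 103, 107, 109, 113, 127} \<inter> {..m}"
    and \<sigma>: "(t - real (card U)) / m + (\<Sum>q\<in>U. 1 / real q) \<le> \<sigma>" "\<sigma> < 1" "m > 0"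
    and B: "8 * ((t - 1) / (1 - \<sigma>) + 2) \<le> B" "(10 / 7 * B) ^ 8 \<le> Q"
  shows "\<exists>K. good_core P Q K"
proof -
  have "card (P \<inter> {2, 3, 5}) \<le> card {2, 3, 5 :: nat}"
    by (intro card_mono) auto
  hence "card (P \<inter> {2, 3, 5}) \<le> 3" by simp
  then obtain K where K: "P \<inter> {2, 3, 5} \<subseteq> K" "K \<subseteq> P" "card K = 3"
    using exists_subset_between[of "P \<inter> {2, 3, 5}" 3 P] P by auto
  have card: "card (P - K) = card P - 3"
    using K P(1) by (simp add: card_Diff_subset finite_subset)
  have "good_core P Q K"
  proof (rule good_coreI[where t = t and \<sigma> = \<sigma> and B = B])
    have "finite U" by (simp add: U)
    have "(\<Sum>q\<in>P - K. 1 / real q) \<le> (real (card (P - K)) - real (card U)) / m + (\<Sum>q\<in>U. 1 / real q)"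
    proof (rule sum_reciprocals_le)
      fix q assume q: "q \<in> P - K - U"
      show "m \<le> q"
      proof (rule ccontr)
        assume "\<not> m \<le> q"
        thus False using primes_less_131[of q] P(2)[of q] q m K(1) by (auto simp: U)
      qed
    qed (use P \<open>finite U\<close> \<open>m > 0\<close> in \<open>auto simp: U\<close>)
    also have "(real (card (P - K)) - real (card U)) / m \<le> (t - real (card U)) / m"
      using P(3,4) card by (intro divide_right_mono) (auto simp: of_nat_diff)
    also have "(t - real (card U)) / m + (\<Sum>q\<in>U. 1 / real q) \<le> \<sigma>" by fact
    finally show "(\<Sum>q\<in>P - K. 1 / real q) \<le> \<sigma>" by simp
  qed (use K card P B \<sigma> in \<open>auto simp: of_nat_diff\<close>)
  thus ?thesis by blast
qed

text \<open>The factor 6 is what the case n = 40 requires; afterwards the left side grows by at most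
  (41/40)^8 < 2 per step.\<close>

lemma pow8_le_pow2:
  fixes n :: nat
  assumes "n \<ge> 40"
  shows "real n ^ 8 \<le> 6 * 2 ^ n"
  using assms
proof (induction n rule: dec_induct)
  case (step n)
  have "real (Suc n) \<le> 41 / 40 * real n" using step by simp
  hence "real (Suc n) ^ 8 \<le> (41 / 40 * real n) ^ 8" by (intro power_mono) auto
  also have "\<dots> = (41 / 40) ^ 8 * real n ^ 8" by (rule power_mult_distrib)
  also have "\<dots> \<le> 2 * real n ^ 8" by (intro mult_right_mono) (auto simp: power_divide)
  also have "\<dots> \<le> 2 * (6 * 2 ^ n)" using step.IH by simp
  finally show ?case by simp
qed auto

text \<open>The constant is the product of the first 18 primes.\<close>

lemma primorial_61_le:
  fixes P :: "nat set"
  assumes P: "finite P" "\<And>q. q \<in> P \<Longrightarrow> prime q" "card P \<ge> 18"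
  shows "117288381359406970983270 \<le> \<Prod>P"
proof -
  let ?U = "{2, 3, 5, 7, 11, 13, 17, 19, 23, 29, 31, 37, 41, 43, 47, 53, 59, 61 :: nat}"
  have "61 ^ card P * \<Prod>?U \<le> 61 ^ card ?U * \<Prod>P"
  proof (rule prod_ge)
    fix q assume q: "q \<in> P - ?U"
    show "61 \<le> q"
    proof (rule ccontr)
      assume "\<not> 61 \<le> q"
      thus False using primes_less_131[of q] P(2)[of q] q by auto
    qed
  qed (use P in auto)
  moreover have "(61::nat) ^ 18 \<le> 61 ^ card P"
    using P by (intro power_increasing) auto
  hence "61 ^ 18 * \<Prod>?U \<le> 61 ^ card P * \<Prod>?U"
    by (rule mult_right_mono) simp
  ultimately have "61 ^ 18 * \<Prod>?U \<le> 61 ^ 18 * \<Prod>P" by simp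
  thus ?thesis by simp
qed

text \<open>The constant is the product of the first 21 primes; every further prime contributes a
  factor of at least 73.\<close>

lemma primorial_73_le:
  fixes P :: "nat set"
  assumes P: "finite P" "\<And>q. q \<in> P \<Longrightarrow> prime q" "card P \<ge> 21"
  shows "40729680599249024150621323470 * 73 ^ (card P - 21) \<le> \<Prod>P"
proof -
  let ?U = "{2, 3, 5, 7, 11, 13, 17, 19, 23, 29, 31, 37, 41, 43, 47, 53, 59, 61, 67, 71, 73 :: nat}"
  have "73 ^ card P * \<Prod>?U \<le> 73 ^ card ?U * \<Prod>P"
  proof (rule prod_ge)
    fix q assume q: "q \<in> P - ?U"
    show "73 \<le> q"
    proof (rule ccontr)
      assume "\<not> 73 \<le> q"
      thus False using primes_less_131[of q] P(2)[of q] q by auto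
    qed
  qed (use P in auto)
  moreover have "(73::nat) ^ card P = 73 ^ 21 * 73 ^ (card P - 21)"
    using P(3) unfolding power_add [symmetric] by simp
  ultimately have "73 ^ 21 * (73 ^ (card P - 21) * \<Prod>?U) \<le> 73 ^ 21 * \<Prod>P"
    by (simp add: mult.assoc)
  hence "73 ^ (card P - 21) * \<Prod>?U \<le> \<Prod>P"
    by (simp only: mult_le_cancel1) simp
  thus ?thesis by (simp add: mult.commute)
qed

text \<open>Each of the \<open>s\<close> sieved primes has at least \<open>s\<close> primes of
  \<open>P\<close> below it, so it is at least \<open>2 * s\<close> and the reciprocal sum is at
  most 1/2. The resulting requirement on \<open>Q\<close> grows about like 32^n, the product of
  \<open>P\<close> at least like 73^n.\<close>

lemma good_core_many:
  fixes P :: "nat set"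
  assumes P: "finite P" "\<And>q. q \<in> P \<Longrightarrow> prime q" "card P \<ge> 40"
    and Q: "real (\<Prod>P) \<le> Q"
  shows "\<exists>K. good_core P Q K"
proof -
  define n where "n = card P"
  define s where "s = n div 2"
  define k where "k = n - s"
  obtain K where K: "K \<subseteq> P" "card K = k" "\<And>x y. x \<in> K \<Longrightarrow> y \<in> P - K \<Longrightarrow> x < y"
    using exists_initial_segment[of P k] P by (auto simp: k_def n_def)
  have card: "card (P - K) = s"
    using K P(1) by (simp add: card_Diff_subset finite_subset k_def s_def n_def)
  have s: "s \<le> k" "s \<ge> 1" using P(3) by (auto simp: s_def k_def n_def)
  have "2 * s \<le> q" if "q \<in> P - K" for q
  proof -
    have "2 * card K < q"
      using K(1) K(3)[OF _ that] P(2) that by (intro card_primes_below) blast+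
    thus ?thesis using K(2) s(1) by linarith
  qed
  hence "real (2 * s) \<le> real q" if "q \<in> P - K" for q
    using that by (intro of_nat_mono)
  moreover have "0 < real (2 * s)" using s(2) by simp
  ultimately have "(\<Sum>q\<in>P - K. 1 / real q) \<le> (\<Sum>q\<in>P - K. 1 / real (2 * s))"
    by (intro sum_mono frac_le order.refl zero_le_one)
  also have "\<dots> = 1 / 2" using card s by simp
  finally have sum_le: "(\<Sum>q\<in>P - K. 1 / real q) \<le> 1 / 2" .

  have k: "2 * k \<le> n + 1" "2 * s \<le> n" by (auto simp: k_def s_def)
  have "((10 / 7) * (2 ^ k * real n)) ^ 8 = (10 / 7) ^ 8 * ((2 ^ k) ^ 8 * real n ^ 8)"
    unfolding power_mult_distrib ..
  \<comment> \<open>Here 18 bounds (10/7)^8, and \<open>2 * k \<le> n + 1\<close> bounds the eighth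
    power of 2^k by 16^(n + 1).\<close>
  also have "\<dots> \<le> 18 * (16 ^ (n + 1) * (6 * 2 ^ n))"
  proof (intro mult_mono)
    have "(2 ^ k) ^ 8 = (2::real) ^ (4 * (2 * k))"
      unfolding power_mult [symmetric] by simp
    also have "\<dots> = 16 ^ (2 * k)"
      unfolding power_mult [of _ 4] by simp
    also have "\<dots> \<le> 16 ^ (n + 1)" using k by (intro power_increasing) auto
    finally show "(2 ^ k) ^ 8 \<le> (16::real) ^ (n + 1)" .
    show "real n ^ 8 \<le> 6 * 2 ^ n" using P(3) by (intro pow8_le_pow2) (simp add: n_def)
  qed (auto simp: power_divide)
  also have "\<dots> = 1728 * ((16 * 2) ^ n :: real)"
    unfolding power_mult_distrib by simp
  also have "\<dots> = 1728 * 32 ^ (40 + (n - 40))"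
    using P(3) by (simp add: n_def)
  also have "\<dots> = 1728 * 32 ^ 40 * (32::real) ^ (n - 40)"
    unfolding power_add by simp
  also have "\<dots> \<le> (40729680599249024150621323470 * 73 ^ 19) * 73 ^ (n - 40)"
    by (rule mult_mono) (simp_all add: power_mono)
  also have "\<dots> = 40729680599249024150621323470 * 73 ^ (n - 21)"
  proof -
    have "n - 21 = 19 + (n - 40)" using P(3) by (simp add: n_def)
    thus ?thesis by (simp only: power_add mult.assoc)
  qed
  also have "\<dots> = real (40729680599249024150621323470 * 73 ^ (n - 21))" by simp
  also have "\<dots> \<le> real (\<Prod>P)"
    unfolding of_nat_le_iff n_def using P by (intro primorial_73_le) auto
  finally have B: "(10 / 7 * (2 ^ k * real n)) ^ 8 \<le> Q" using Q by linarith
  have "2 ^ k * ((real s - 1) / (1 - 1 / 2) + 2) \<le> 2 ^ k * real n"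
    using k by (intro mult_left_mono) auto
  hence "good_core P Q K"
    using K(1) sum_le card s(2) B unfolding K(2) [symmetric]
    by (intro good_coreI[where t = "real s" and \<sigma> = "1 / 2" and B = "2 ^ card K * real n"]) simp_all
  thus ?thesis by blast
qed

text \<open>More primes force a larger \<open>Q\<close>, which permits a larger \<open>B\<close>. In
  the three middle ranges \<open>t\<close> is the maximal cardinality minus 3,
  \<open>\<sigma>\<close> bounds the extremal reciprocal sum, and \<open>B\<close> is the resulting
  bound rounded up.\<close>

lemma exists_good_core:
  fixes P :: "nat set"
  assumes P: "finite P" "\<And>q. q \<in> P \<Longrightarrow> prime q"
    and Q: "real (\<Prod>P) \<le> Q" "10 ^ 22 \<le> Q"
  shows "\<exists>K. good_core P Q K"
proof -
  consider "card P < 3" | "3 \<le> card P" "card P \<le> 17" | "18 \<le> card P" "card P \<le> 20"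
    | "21 \<le> card P" "card P \<le> 39" | "40 \<le> card P" by linarith
  thus ?thesis
  proof cases
    case 1
    have "(2::real) ^ card P \<le> 2 ^ 2"
      using 1 by (intro power_increasing) auto
    hence "good_core P Q P"
      \<comment> \<open>All of \<open>P\<close> is the core, so nothing is sieved and B = 4 *
        2.\<close>
      using Q by (intro good_coreI[where t = 1 and \<sigma> = 0 and B = 8]) (auto simp: power_divide)
    thus ?thesis by blast
  next
    case 2
    show ?thesis
      by (rule good_core_3[where P = P and m = 59 and t = 14 and \<sigma> = "6642 / 10000" and B = 326 and Q = Q
            and U = "{7, 11, 13, 17, 19, 23, 29, 31, 37, 41, 43, 47, 53, 59}"])
         (use P 2 Q in \<open>auto simp: power_divide\<close>)
  next
    case 3
    have "real 117288381359406970983270 \<le> real (\<Prod>P)"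
      using P 3 by (simp only: of_nat_le_iff primorial_61_le)
    hence Q': "117288381359406970983270 \<le> Q" using Q by simp
    show ?thesis
      by (rule good_core_3[where P = P and m = 71 and t = 17 and \<sigma> = "71 / 100" and B = 458 and Q = Q
            and U = "{7, 11, 13, 17, 19, 23, 29, 31, 37, 41, 43, 47, 53, 59, 61, 67, 71}"])
         (use P 3 Q' in \<open>auto simp: power_divide\<close>)
  next
    case 4
    have "40729680599249024150621323470 * 1 \<le> 40729680599249024150621323470 * (73::nat) ^ (card P - 21)"
      by (intro mult_left_mono) auto
    also have "\<dots> \<le> \<Prod>P" using P 4 by (intro primorial_73_le) auto
    finally have "real 40729680599249024150621323470 \<le> real (\<Prod>P)"
      by (simp only: of_nat_le_iff mult_1_right)
    hence Q': "40729680599249024150621323470 \<le> Q" using Q by simp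
    show ?thesis
      \<comment> \<open>\<open>U\<close> has 28 elements; the other at most 8 sieved primes are
        counted as 1/127 each.\<close>
      by (rule good_core_3[where P = P and m = 127 and t = 36 and \<sigma> = "8874 / 10000" and B = 2504 and Q = Q
            and U = "{7, 11, 13, 17, 19, 23, 29, 31, 37, 41, 43, 47, 53, 59, 61, 67, 71, 73,
                      79, 83, 89, 97, 101, 103, 107, 109, 113, 127}"])
         (use P 4 Q' in \<open>auto simp: power_divide\<close>)
  next
    case 5
    thus ?thesis using good_core_many P Q by blast
  qed
qed

lemma prod_prime_factors_le:
  fixes n :: nat
  assumes "n > 0"
  shows "\<Prod>(prime_factors n) \<le> n"
proof -
  have "\<Prod>(prime_factors n) \<le> (\<Prod>q\<in>prime_factors n. q ^ multiplicity q n)"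
  proof (intro prod_mono conjI)
    fix q assume q: "q \<in> prime_factors n"
    hence "multiplicity q n > 0" "q > 0"
      by (auto simp: prime_factors_multiplicity intro: prime_gt_0_nat)
    thus "q \<le> q ^ multiplicity q n" by (intro self_le_power) auto
  qed auto
  also have "\<dots> = n" using assms by (simp add: prime_factorization_nat [symmetric])
  finally show ?thesis .
qed

theorem corollary1:
  fixes p :: nat
  assumes "prime p" and "p \<ge> 10 ^ 22"
  shows "real (least_primroot p) < real p powr (5 / 8)"
proof -
  let ?P = "prime_factors (p - 1)"
  \<comment> \<open>The radical of \<open>p - 1\<close> is below \<open>p\<close>, so the core can
    be chosen with Q = p.\<close>
  have "\<Prod>?P \<le> p - 1"
    using assms by (intro prod_prime_factors_le) auto
  hence "\<Prod>?P \<le> p" by linarith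
  hence "real (\<Prod>?P) \<le> real p" by (rule of_nat_mono)
  moreover have "10 ^ 22 \<le> real p"
    using assms(2) by (metis of_nat_le_iff of_nat_numeral of_nat_power)
  ultimately obtain K where K: "good_core ?P (real p) K"
    using exists_good_core[of ?P "real p"] by auto
  then obtain B where B: "2 ^ card K * ((real (card (?P - K)) - 1) / (1 - (\<Sum>q\<in>?P - K. 1 / q)) + 2) \<le> B"
    "(10 / 7 * B) ^ 8 \<le> real p"
    by (auto simp: good_core_def)
  show ?thesis
    using K by (intro least_primroot_less[OF assms _ _ B]) (auto simp: good_core_def)
qed

end
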